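(* Let $\mathbb{B}$ be a separable Banach space with norm $\|\cdot\|$, $(\Omega,\mathcal{F},\mathbb{P})$ a probability space, $(Y_n)$ a sequence of $\mathbb{B}$-valued random variables and $Z_n:=\sum_{i=0}^n Y_i$. Let $(a_n)$ be reals with $0<a_0\le a_1\le\cdots$ and $a_n\to\infty$, and let $f(x):=\min\{n\in\mathbb{N}:a_n\ge x\}$ for $x\ge 0$. Let $\psi:\mathbb{Q}^+\times\mathbb{Q}^+\to\mathbb{N}$, let $(z_n)$ be a sequence of natural numbers, $\varepsilon,\lambda\in\mathbb{Q}^+$ and $k\in\mathbb{N}$, and set $M:=\psi(\varepsilon/4,\lambda/2)$. Suppose $$\mathbb{P}\left(\bigcup_{i=0}^M\{\|Z_i\|\ge z_M\}\right)\le\frac{\lambda}{2}\quad\text{and}\quad\mathbb{P}\left(\max_{M\le m\le k}\|Z_M-Z_m\|\ge\frac{\varepsilon}{4}\right)<\frac{\lambda}{2}.$$ Then $N:=\max\left\{M,\ f\left(\frac{4a_Mz_M}{\varepsilon}\right)\right\}$ satisfies $$\mathbb{P}\left(\max_{N\le n\le k}\left\|\frac{1}{a_n}\sum_{i=0}^n a_iY_i\right\|\ge\varepsilon\right)<\lambda.$$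
   Context: Random variables are tight (Radon) Borel measurable maps $\Omega\to\mathbb{B}$. A maximum over an empty index range is understood so that the corresponding event is empty. *)

theory Defs
  imports "HOL-Probability.Probability"
begin

definition tight_random_variable ::
    "'w measure \<Rightarrow> ('w \<Rightarrow> 'b :: real_normed_vector) \<Rightarrow> bool" where
  "tight_random_variable P X \<longleftrightarrow>
     X \<in> borel_measurable P \<and>
     (\<forall>e>0. \<exists>K. compact K \<and> measure P {\<omega> \<in> space P. X \<omega> \<notin> K} < e)"

text \<open>By Ulam's theorem the tightness clause is automatic in a separable Banach space.\<close>

lemma tight_random_variable_iff_borel_measurable:
  fixes X :: "'w \<Rightarrow> 'b :: {banach, second_countable_topology}"
  assumes "prob_space P"
  shows "tight_random_variable P X \<longleftrightarrow> X \<in> borel_measurable P"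
proof
  assume X: "X \<in> borel_measurable P"
  interpret P: prob_space P by fact
  interpret D: prob_space "distr P borel X" using X by (rule P.prob_space_distr)
  have "\<exists>K. compact K \<and> measure P {\<omega> \<in> space P. X \<omega> \<notin> K} < e" if e: "e > 0" for e :: real
  proof -
    have "emeasure (distr P borel X) UNIV =
        (SUP K \<in> {K. K \<subseteq> UNIV \<and> compact K}. emeasure (distr P borel X) K)"
      by (rule inner_regular) (auto simp: D.emeasure_finite)
    moreover have "ennreal (1 - e) < emeasure (distr P borel X) UNIV"
      using e D.emeasure_space_1 by (simp add: ennreal_less_one_iff)
    ultimately obtain K where K: "compact K" "ennreal (1 - e) < emeasure (distr P borel X) K"
      by (auto simp: less_SUP_iff)
    then have KB: "K \<in> sets borel" by (simp add: compact_imp_closed)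
    have "1 - e < measure (distr P borel X) K"
      using K(2) ennreal_leI[of "measure (distr P borel X) K" "1 - e"]
      by (auto simp: D.emeasure_eq_measure not_le[symmetric])
    also have "\<dots> = P.prob {\<omega> \<in> space P. X \<omega> \<in> K}"
      using X KB by (simp add: measure_distr vimage_def Int_def conj_commute)
    finally have "1 - e < P.prob {\<omega> \<in> space P. X \<omega> \<in> K}" .
    moreover have "{\<omega> \<in> space P. X \<omega> \<in> K} \<in> P.events"
      using X KB by measurable
    then have "P.prob {\<omega> \<in> space P. X \<omega> \<notin> K} = 1 - P.prob {\<omega> \<in> space P. X \<omega> \<in> K}"
      by (rule P.prob_neg)
    ultimately show ?thesis using K(1) by (intro exI[of _ K]) auto
  qed
  with X show "tight_random_variable P X" by (simp add: tight_random_variable_def)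
qed (simp add: tight_random_variable_def)

definition first_index_ge :: "(nat \<Rightarrow> real) \<Rightarrow> real \<Rightarrow> nat" where
  "first_index_ge a x = (LEAST n. a n \<ge> x)"

end

theory Submission
  imports Defs
begin

text \<open>
  By Abel summation, \<open>\<Sum>i=m..n. a i *\<^sub>R y i\<close> with \<open>0 \<le> a m \<le> \<dots> \<le> a n\<close> has norm at most
  \<open>(2 * a n - a m) * c\<close> whenever the partial sums of \<open>y\<close> starting at \<open>m\<close> are bounded by \<open>c\<close>. Off the
  two exceptional events, this applies to \<open>Y 0, \<dots>, Y M\<close> with \<open>c = z M\<close> and to
  \<open>Y (M + 1), \<dots>, Y n\<close> with \<open>c = \<epsilon> / 4\<close>. As \<open>a n \<ge> 4 * a M * z M / \<epsilon>\<close> for \<open>n \<ge> N\<close>, each part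
  contributes at most \<open>\<epsilon> / 2\<close> after division by \<open>a n\<close>, and the first one strictly less.
\<close>

lemma sum_scaleR_by_parts:
  fixes a :: "nat \<Rightarrow> real" and y :: "nat \<Rightarrow> 'b :: real_vector"
  assumes "m \<le> n"
  shows "(\<Sum>i=m..n. a i *\<^sub>R y i) =
    a n *\<^sub>R (\<Sum>i=m..n. y i) - (\<Sum>j=m..<n. (a (Suc j) - a j) *\<^sub>R (\<Sum>i=m..j. y i))"
  using assms by (induction rule: dec_induct) (simp_all add: algebra_simps)

lemma norm_sum_scaleR_le:
  fixes a :: "nat \<Rightarrow> real" and y :: "nat \<Rightarrow> 'b :: real_normed_vector"
  assumes "m \<le> n" and mono: "mono_on {m..n} a" and "0 \<le> a n"
    and partial_sums_le: "\<And>j. m \<le> j \<Longrightarrow> j \<le> n \<Longrightarrow> norm (\<Sum>i=m..j. y i) \<le> c"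
  shows "norm (\<Sum>i=m..n. a i *\<^sub>R y i) \<le> (2 * a n - a m) * c"
proof -
  have "norm (\<Sum>i=m..n. a i *\<^sub>R y i) \<le>
      norm (a n *\<^sub>R (\<Sum>i=m..n. y i)) + norm (\<Sum>j=m..<n. (a (Suc j) - a j) *\<^sub>R (\<Sum>i=m..j. y i))"
    unfolding sum_scaleR_by_parts[OF \<open>m \<le> n\<close>] by (rule norm_triangle_ineq4)
  also have "norm (a n *\<^sub>R (\<Sum>i=m..n. y i)) \<le> a n * c"
    using \<open>m \<le> n\<close> \<open>0 \<le> a n\<close> partial_sums_le[of n] by (simp add: mult_left_mono)
  also have "norm (\<Sum>j=m..<n. (a (Suc j) - a j) *\<^sub>R (\<Sum>i=m..j. y i)) \<le>
      (\<Sum>j=m..<n. (a (Suc j) - a j) * c)"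
    using mono_onD[OF mono] partial_sums_le
    by (intro sum_norm_le) (simp add: mult_left_mono)
  also have "\<dots> = (a n - a m) * c"
    using \<open>m \<le> n\<close> by (simp add: sum_distrib_right[symmetric] sum_Suc_diff')
  finally show ?thesis
    by (simp add: algebra_simps)
qed

lemma norm_sum_scaleR_init_tail_less:
  fixes a :: "nat \<Rightarrow> real" and y :: "nat \<Rightarrow> 'b :: real_normed_vector"
  assumes "0 < a 0" and "incseq a" and "M \<le> n"
    and init: "\<And>j. j \<le> M \<Longrightarrow> norm (\<Sum>i=0..j. y i) < c"
    and tail: "\<And>j. M \<le> j \<Longrightarrow> j \<le> n \<Longrightarrow> norm ((\<Sum>i=0..M. y i) - (\<Sum>i=0..j. y i)) \<le> d"
  shows "norm (\<Sum>i=0..n. a i *\<^sub>R y i) < 2 * a M * c + 2 * a n * d"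
proof -
  have pos: "0 < a i" for i
    using \<open>0 < a 0\<close> incseqD[OF \<open>incseq a\<close>, of 0 i] by simp
  have mono: "mono_on I a" for I
    using \<open>incseq a\<close> by (rule mono_imp_mono_on)
  have split: "(\<Sum>i=0..j. x i) = (\<Sum>i=0..M. x i) + (\<Sum>i=Suc M..j. x i)"
    if "M \<le> j" for j and x :: "nat \<Rightarrow> 'b"
    using sum.ub_add_nat[of 0 M x "j - M"] that by simp
  have "0 < c"
    using init[of 0] by (auto intro: le_less_trans[OF norm_ge_zero])
  have "norm (\<Sum>i=0..M. a i *\<^sub>R y i) \<le> (2 * a M - a 0) * c"
    using init pos[of M] by (intro norm_sum_scaleR_le mono) (auto intro: less_imp_le)
  also have "\<dots> < 2 * a M * c"
    using \<open>0 < a 0\<close> \<open>0 < c\<close> by simp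
  finally have init_less: "norm (\<Sum>i=0..M. a i *\<^sub>R y i) < 2 * a M * c" .
  have "0 \<le> d"
    using tail[of M] \<open>M \<le> n\<close> by simp
  have tail_le: "norm (\<Sum>i=Suc M..n. a i *\<^sub>R y i) \<le> 2 * a n * d"
  proof (cases "M = n")
    case False
    have "norm (\<Sum>i=Suc M..j. y i) \<le> d" if "Suc M \<le> j" "j \<le> n" for j
      using tail[of j] split[of j y] that by simp
    then have "norm (\<Sum>i=Suc M..n. a i *\<^sub>R y i) \<le> (2 * a n - a (Suc M)) * d"
      using False \<open>M \<le> n\<close> pos[of n] by (intro norm_sum_scaleR_le mono) auto
    also have "\<dots> \<le> 2 * a n * d"
      using \<open>0 \<le> d\<close> pos[of "Suc M"] by (intro mult_right_mono) auto
    finally show ?thesis .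
  qed (use \<open>0 \<le> d\<close> pos[of n] in simp)
  from split[OF \<open>M \<le> n\<close>] have "norm (\<Sum>i=0..n. a i *\<^sub>R y i) \<le>
      norm (\<Sum>i=0..M. a i *\<^sub>R y i) + norm (\<Sum>i=Suc M..n. a i *\<^sub>R y i)"
    by (simp add: norm_triangle_ineq)
  with init_less tail_le show ?thesis
    by linarith
qed

lemma norm_weighted_mean_less:
  fixes a :: "nat \<Rightarrow> real" and y :: "nat \<Rightarrow> 'b :: real_normed_vector"
  assumes "0 < a 0" and "incseq a" and "M \<le> n"
    and "0 < e" and "4 * a M * c / e \<le> a n"
    and init: "\<And>j. j \<le> M \<Longrightarrow> norm (\<Sum>i=0..j. y i) < c"
    and tail: "\<And>j. M \<le> j \<Longrightarrow> j \<le> n \<Longrightarrow> norm ((\<Sum>i=0..M. y i) - (\<Sum>i=0..j. y i)) \<le> e / 4"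
  shows "norm ((1 / a n) *\<^sub>R (\<Sum>i=0..n. a i *\<^sub>R y i)) < e"
proof -
  have "0 < a n"
    using \<open>0 < a 0\<close> incseqD[OF \<open>incseq a\<close>, of 0 n] by simp
  have "norm (\<Sum>i=0..n. a i *\<^sub>R y i) < 2 * a M * c + 2 * a n * (e / 4)"
    using assms(1-3) init tail by (rule norm_sum_scaleR_init_tail_less)
  also have "\<dots> \<le> a n * e"
    using \<open>0 < e\<close> \<open>4 * a M * c / e \<le> a n\<close> by (simp add: field_simps)
  finally show ?thesis
    using \<open>0 < a n\<close> by (simp add: field_simps)
qed

lemma UN_norm_weighted_mean_ge_subset:
  fixes a :: "nat \<Rightarrow> real" and Y :: "nat \<Rightarrow> 'w \<Rightarrow> 'b :: real_normed_vector"
  assumes "0 < a 0" and "incseq a" and "0 < e" and "M \<le> N" and "4 * a M * c / e \<le> a N"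
  shows "(\<Union>n\<in>{N..k}. {\<omega> \<in> \<Omega>. e \<le> norm ((1 / a n) *\<^sub>R (\<Sum>i=0..n. a i *\<^sub>R Y i \<omega>))}) \<subseteq>
    (\<Union>j\<in>{0..M}. {\<omega> \<in> \<Omega>. c \<le> norm (\<Sum>i=0..j. Y i \<omega>)}) \<union>
    (\<Union>m\<in>{M..k}. {\<omega> \<in> \<Omega>. e / 4 \<le> norm ((\<Sum>i=0..M. Y i \<omega>) - (\<Sum>i=0..m. Y i \<omega>))})"
    (is "?mean \<subseteq> ?init \<union> ?tail")
proof
  fix \<omega> assume "\<omega> \<in> ?mean"
  then obtain n where "\<omega> \<in> \<Omega>" and n: "N \<le> n" "n \<le> k"
    and mean_ge: "e \<le> norm ((1 / a n) *\<^sub>R (\<Sum>i=0..n. a i *\<^sub>R Y i \<omega>))"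
    by auto
  show "\<omega> \<in> ?init \<union> ?tail"
  proof (rule ccontr)
    assume "\<omega> \<notin> ?init \<union> ?tail"
    with \<open>\<omega> \<in> \<Omega>\<close> n
    have init: "\<And>j. j \<le> M \<Longrightarrow> norm (\<Sum>i=0..j. Y i \<omega>) < c"
      and tail: "\<And>m. M \<le> m \<Longrightarrow> m \<le> n \<Longrightarrow>
        norm ((\<Sum>i=0..M. Y i \<omega>) - (\<Sum>i=0..m. Y i \<omega>)) \<le> e / 4"
      by (auto simp: not_le less_imp_le)
    have "M \<le> n" and "4 * a M * c / e \<le> a n"
      using \<open>M \<le> N\<close> \<open>4 * a M * c / e \<le> a N\<close> n incseqD[OF \<open>incseq a\<close>, of N n] by auto
    with init tail have "norm ((1 / a n) *\<^sub>R (\<Sum>i=0..n. a i *\<^sub>R Y i \<omega>)) < e"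
      by (intro norm_weighted_mean_less assms(1-3))
    with mean_ge show False by simp
  qed
qed

lemma first_index_ge_le_iff:
  assumes "incseq a" and unbounded: "filterlim a at_top sequentially"
  shows "first_index_ge a x \<le> n \<longleftrightarrow> x \<le> a n"
proof
  obtain m where "x \<le> a m"
    using unbounded by (auto simp: filterlim_at_top eventually_sequentially)
  then have "x \<le> a (first_index_ge a x)"
    unfolding first_index_ge_def by (rule LeastI)
  also assume "first_index_ge a x \<le> n"
  then have "a (first_index_ge a x) \<le> a n"
    by (rule incseqD[OF \<open>incseq a\<close>])
  finally show "x \<le> a n" .
qed (simp add: first_index_ge_def Least_le)

lemma Collect_le_Max_eq_UN:
  fixes X :: "'i \<Rightarrow> 'w \<Rightarrow> 'a :: linorder"
  assumes "finite I"
  shows "{\<omega> \<in> \<Omega>. I \<noteq> {} \<and> c \<le> Max ((\<lambda>i. X i \<omega>) ` I)} = (\<Union>i\<in>I. {\<omega> \<in> \<Omega>. c \<le> X i \<omega>})"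
  using assms by (cases "I = {}") (auto simp: Max_ge_iff)

theorem theorem4p3:
  fixes P :: "'w measure"
    and Y :: "nat \<Rightarrow> 'w \<Rightarrow> 'b :: {banach, second_countable_topology}"
    and Z :: "nat \<Rightarrow> 'w \<Rightarrow> 'b"
    and a :: "nat \<Rightarrow> real"
    and f :: "real \<Rightarrow> nat"
    and \<psi> :: "rat \<times> rat \<Rightarrow> nat"
    and z :: "nat \<Rightarrow> nat"
    and \<epsilon> lam :: rat
    and k M N :: nat
  assumes "prob_space P"
    and "\<And>n. tight_random_variable P (Y n)"
    and "0 < a 0" and "incseq a" and "filterlim a at_top sequentially"
    and "\<epsilon> > 0" and "lam > 0"
  defines "Z \<equiv> \<lambda>n \<omega>. \<Sum>i=0..n. Y i \<omega>"
    and "f \<equiv> \<lambda>x. first_index_ge a x"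
    and "M \<equiv> \<psi> (\<epsilon> / 4, lam / 2)"
    and "N \<equiv> max M (f (4 * a M * real (z M) / real_of_rat \<epsilon>))"
  assumes "measure P (\<Union>i\<in>{0..M}. {\<omega> \<in> space P. norm (Z i \<omega>) \<ge> real (z M)})
             \<le> real_of_rat lam / 2"
    and "measure P {\<omega> \<in> space P. {M..k} \<noteq> {} \<and>
             Max ((\<lambda>m. norm (Z M \<omega> - Z m \<omega>)) ` {M..k}) \<ge> real_of_rat \<epsilon> / 4}
             < real_of_rat lam / 2"
  shows "measure P {\<omega> \<in> space P. {N..k} \<noteq> {} \<and>
             Max ((\<lambda>n. norm ((1 / a n) *\<^sub>R (\<Sum>i=0..n. a i *\<^sub>R Y i \<omega>))) ` {N..k})
               \<ge> real_of_rat \<epsilon>}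
             < real_of_rat lam"
proof -
  interpret P: prob_space P by fact
  have [measurable]: "Z n \<in> borel_measurable P" for n
    using \<open>\<And>n. tight_random_variable P (Y n)\<close>
    unfolding Z_def tight_random_variable_def
    by (intro borel_measurable_sum) simp
  let ?e = "real_of_rat \<epsilon>"
  let ?init = "\<Union>i\<in>{0..M}. {\<omega> \<in> space P. norm (Z i \<omega>) \<ge> real (z M)}"
  let ?tail = "\<Union>m\<in>{M..k}. {\<omega> \<in> space P. norm (Z M \<omega> - Z m \<omega>) \<ge> ?e / 4}"
  let ?mean = "\<Union>n\<in>{N..k}. {\<omega> \<in> space P. norm ((1 / a n) *\<^sub>R (\<Sum>i=0..n. a i *\<^sub>R Y i \<omega>)) \<ge> ?e}"
  have events: "?init \<in> P.events" "?tail \<in> P.events"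
    by measurable
  have "M \<le> N" and "4 * a M * real (z M) / ?e \<le> a N"
    by (simp_all add: N_def f_def flip: first_index_ge_le_iff[OF \<open>incseq a\<close> \<open>filterlim a at_top sequentially\<close>])
  with \<open>0 < a 0\<close> \<open>incseq a\<close> \<open>\<epsilon> > 0\<close> have "?mean \<subseteq> ?init \<union> ?tail"
    unfolding Z_def by (intro UN_norm_weighted_mean_ge_subset) auto
  with events have "P.prob ?mean \<le> P.prob (?init \<union> ?tail)"
    by (intro P.finite_measure_mono) auto
  also have "\<dots> \<le> P.prob ?init + P.prob ?tail"
    using events by (rule measure_Un_le)
  also have "\<dots> < real_of_rat lam"
    using assms(12,13) unfolding Collect_le_Max_eq_UN[OF finite_atLeastAtMost] by linarith
  finally show ?thesis
    unfolding Collect_le_Max_eq_UN[OF finite_atLeastAtMost] .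
qed

end
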